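(* Let $P$ be a normal fuzzy logic program over a complete lattice $(V,\leqslant)$ and a set of atoms $\Pi$ such that for every atom $p\in\Pi$ the program contains exactly one rule $p\leftarrow\mathcal{B}_p$ (of weight $1$). Let $X_{\mathsf{SWF}}$ be the approximate well-founded model of $P$, i.e. $X_{\mathsf{SWF}}=\mathit{lfp}_{\leq_p}(\mathcal{AW}_P)$. Then $\zeta(X_{\mathsf{SWF}})=\mathit{lfp}(\mathcal{T}_P^{\mathit{st}})$, where $\mathit{lfp}(\mathcal{T}_P^{\mathit{st}})$ is the $\leq_p$-least fixpoint of the stable operator of $\mathcal{T}_P$.
   Context: Setting. $(V,\leqslant)$ is a complete lattice of truth values with least element $0$, greatest element $1$, join $\vee$ and meet $\wedge$; $V'\subseteq V$ is a designated subset of truth values allowed as constants; $\Pi$ is a set of atoms. Each $n$-ary connective $f$ has a truth function $f^{\cdot}\colon V^n\to V$. Truth functions of conjunctors, disjunctors and aggregators are monotone in each argument; a conjunctor $\&$ satisfies $x\mathbin{\&^{\cdot}}y\leqslant x$, $x\mathbin{\&^{\cdot}}y\leqslant y$, $x\mathbin{\&^{\cdot}}1=x=1\mathbin{\&^{\cdot}}x$; a disjunctor $|$ satisfies $x\leqslant x\mathbin{|^{\cdot}}y$, $y\leqslant x\mathbin{|^{\cdot}}y$, $x\mathbin{|^{\cdot}}0=x=0\mathbin{|^{\cdot}}x$. Default negation $\sim$ has a truth function $\sim^{\cdot}\colon V\to V$ that is an antimonotone involution. Normal fuzzy formulas are built from constants $c\in V'$, atoms $p$ and negated atoms $\sim p$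 ($p\in\Pi$) using conjunctors, disjunctors and aggregators. A normal fuzzy logic program is a finite set of rules (head an atom, body a normal fuzzy formula, with a weight in $V'$; here all weights are $1$). Interpretations are functions $I\colon\Pi\to V$, ordered pointwise ($\leq$); $\mathcal{I}$ is the complete lattice of all of them; $\mathbf{0},\mathbf{1}$ are its least and greatest elements. On $\mathcal{I}^2$: $(L_1,U_1)\leq_p(L_2,U_2)$ iff $L_1\leq L_2$ and $U_2\leq U_1$; $(L_1,U_1)\leq_t(L_2,U_2)$ iff $L_1\leq L_2$ and $U_1\leq U_2$. $(x)_1,(x)_2$ denote the components of a pair. Evaluation under a pair: $\widehat{(L,U)}(c)=c$, $\widehat{(L,U)}(p)=L(p)$, $\widehat{(L,U)}(\sim p)=\sim^{\cdot}U(p)$, and $\widehat{(L,U)}(f(\varphi_1,\dots,\varphi_n))=f^{\cdot}(\widehat{(L,U)}(\varphi_1),\dots,\widehat{(L,U)}(\varphi_n))$. Operator $\mathcal{T}_P\colon\mathcal{I}^2\to\mathcal{I}^2$: since every atom has exactly one rule, of weight $1$, $\mathcal{T}_P(L,U)_1(p)=\widehat{(L,U)}(\mathcal{B}_p)$ and $\mathcal{T}_P(L,U)_2=\mathcal{T}_P(U,L)_1$. It is $\leq_p$-monotone. Its stable operator is $\mathcal{T}_P^{\mathit{st}}(L,U)=(\mathit{lfp}(\mathcal{T}_P(\cdot,U)_1),\mathit{lfp}(\mathcal{T}_P(L,\cdot)_2))$ (least fixpoints in $(\mathcal{I},\leq)$ of monotone operators), which is $\leq_p$-monotone. Approximate interpretations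 are functions $X\colon\Pi\to V\times V$; $\zeta(X)=(L,U)$ is the pair of interpretations with $X(p)=(L(p),U(p))$ for all $p$; $\zeta$ is a bijection onto $\mathcal{I}^2$ and the orders $\leq_p,\leq_t$ are transported along it. For approximate interpretations, pointwise: $(x_1,y_1)\otimes(x_2,y_2)=(x_1\wedge x_2,y_1\vee y_2)$ and $(x_1,y_1)\oplus(x_2,y_2)=(x_1\vee x_2,y_1\wedge y_2)$. Evaluation: $\hat X(c)=(c,c)$, $\hat X(p)=X(p)$, $\hat X(\sim p)=(\sim^{\cdot}u,\sim^{\cdot}\ell)$ if $X(p)=(\ell,u)$, and connectives are applied componentwise: if $\hat X(\varphi_k)=(\ell_k,u_k)$ then $\hat X(f(\varphi_1,\dots,\varphi_n))=(f^{\cdot}(\ell_1,\dots,\ell_n),f^{\cdot}(u_1,\dots,u_n))$. Define $\mathcal{S}_P(X)(p)=\hat X(\mathcal{B}_p)$. Let $X_{\mathtt f}$ be the approximate interpretation with $\zeta(X_{\mathtt f})=(\mathbf{0},\mathbf{0})$. For an approximate interpretation $X$ let $F_{P,X}(Y)=X_{\mathtt f}\otimes\mathcal{S}_P(X\oplus Y)$ and $s_P(X)=\mathit{lfp}_{\leq_t}(F_{P,X})$, its $\leq_t$-least fixpoint. The approximate well-founded operator is $\mathcal{AW}_P(X)=\mathcal{S}_P(X)\oplus s_P(X)$, which is $\leq_p$-monotone. *)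

theory Defs
  imports Main
begin

section \<open>Normal fuzzy logic programs\<close>

text \<open>
  Truth values are the elements of a type of class \<open>complete_lattice\<close>, atoms are the elements of
  the type \<open>'p\<close>.  Conjunctors, disjunctors and aggregators are named by the elements of
  \<open>'c\<close>, \<open>'d\<close> and \<open>'a\<close>.  An aggregator of arity \<open>n\<close> is interpreted on lists; its values on lists of
  any other length are irrelevant.
\<close>

record ('v, 'c, 'd, 'a) fuzzy_logic =
  constants :: "'v set"
  conj_tf :: "'c \<Rightarrow> 'v \<Rightarrow> 'v \<Rightarrow> 'v"
  disj_tf :: "'d \<Rightarrow> 'v \<Rightarrow> 'v \<Rightarrow> 'v"
  arity :: "'a \<Rightarrow> nat"
  aggr_tf :: "'a \<Rightarrow> 'v list \<Rightarrow> 'v"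
  neg_tf :: "'v \<Rightarrow> 'v"

locale fuzzy_logic =
  fixes S :: "('v::complete_lattice, 'c, 'd, 'a) fuzzy_logic"
  assumes conj_mono1: "x \<le> x' \<Longrightarrow> conj_tf S c x y \<le> conj_tf S c x' y"
    and conj_mono2: "y \<le> y' \<Longrightarrow> conj_tf S c x y \<le> conj_tf S c x y'"
    and conj_le1: "conj_tf S c x y \<le> x"
    and conj_le2: "conj_tf S c x y \<le> y"
    and conj_top_right: "conj_tf S c x top = x"
    and conj_top_left: "conj_tf S c top x = x"
    and disj_mono1: "x \<le> x' \<Longrightarrow> disj_tf S d x y \<le> disj_tf S d x' y"
    and disj_mono2: "y \<le> y' \<Longrightarrow> disj_tf S d x y \<le> disj_tf S d x y'"
    and disj_ge1: "x \<le> disj_tf S d x y"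
    and disj_ge2: "y \<le> disj_tf S d x y"
    and disj_bot_right: "disj_tf S d x bot = x"
    and disj_bot_left: "disj_tf S d bot x = x"
    and aggr_mono: "\<lbrakk>length vs = arity S a; i < arity S a; vs ! i \<le> y\<rbrakk>
                      \<Longrightarrow> aggr_tf S a vs \<le> aggr_tf S a (vs[i := y])"
    and neg_antimono: "antimono (neg_tf S)"
    and neg_invol: "neg_tf S (neg_tf S x) = x"

datatype ('p, 'v, 'c, 'd, 'a) fuzzy_formula =
    Const 'v
  | Atom 'p
  | NegAtom 'p
  | Conj 'c "('p, 'v, 'c, 'd, 'a) fuzzy_formula" "('p, 'v, 'c, 'd, 'a) fuzzy_formula"
  | Disj 'd "('p, 'v, 'c, 'd, 'a) fuzzy_formula" "('p, 'v, 'c, 'd, 'a) fuzzy_formula"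
  | Aggr 'a "('p, 'v, 'c, 'd, 'a) fuzzy_formula list"

primrec wf_formula ::
  "('v, 'c, 'd, 'a) fuzzy_logic \<Rightarrow> ('p, 'v, 'c, 'd, 'a) fuzzy_formula \<Rightarrow> bool" where
  "wf_formula S (Const v) \<longleftrightarrow> v \<in> constants S"
| "wf_formula S (Atom p) \<longleftrightarrow> True"
| "wf_formula S (NegAtom p) \<longleftrightarrow> True"
| "wf_formula S (Conj c \<phi> \<psi>) \<longleftrightarrow> wf_formula S \<phi> \<and> wf_formula S \<psi>"
| "wf_formula S (Disj d \<phi> \<psi>) \<longleftrightarrow> wf_formula S \<phi> \<and> wf_formula S \<psi>"
| "wf_formula S (Aggr a \<phi>s) \<longleftrightarrow> length \<phi>s = arity S a \<and> list_all id (map (wf_formula S) \<phi>s)"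

datatype ('p, 'v, 'c, 'd, 'a) fuzzy_rule =
  Rule (rhead: 'p) (rbody: "('p, 'v, 'c, 'd, 'a) fuzzy_formula") (weight: 'v)

definition normal_program ::
  "('v, 'c, 'd, 'a) fuzzy_logic \<Rightarrow> ('p, 'v, 'c, 'd, 'a) fuzzy_rule set \<Rightarrow> bool" where
  "normal_program S P \<longleftrightarrow>
     finite P \<and> (\<forall>r\<in>P. wf_formula S (rbody r) \<and> weight r \<in> constants S)"

text \<open>The body of the rule for \<open>p\<close>; meaningful for programs with exactly one rule per atom.\<close>

definition body_of ::
  "('p, 'v, 'c, 'd, 'a) fuzzy_rule set \<Rightarrow> 'p \<Rightarrow> ('p, 'v, 'c, 'd, 'a) fuzzy_formula" where
  "body_of P p = rbody (THE r. r \<in> P \<and> rhead r = p)"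


section \<open>Orders and least fixpoints\<close>

type_synonym ('p, 'v) interp = "'p \<Rightarrow> 'v"
type_synonym ('p, 'v) approx = "'p \<Rightarrow> 'v \<times> 'v"

definition le_p :: "'i::order \<times> 'i \<Rightarrow> 'i \<times> 'i \<Rightarrow> bool" where
  "le_p x y \<longleftrightarrow> fst x \<le> fst y \<and> snd y \<le> snd x"

definition le_t :: "'i::order \<times> 'i \<Rightarrow> 'i \<times> 'i \<Rightarrow> bool" where
  "le_t x y \<longleftrightarrow> fst x \<le> fst y \<and> snd x \<le> snd y"

definition zeta :: "('p, 'v) approx \<Rightarrow> ('p, 'v) interp \<times> ('p, 'v) interp" where
  "zeta X = (\<lambda>p. fst (X p), \<lambda>p. snd (X p))"

definition approx_le_p :: "('p, 'v::order) approx \<Rightarrow> ('p, 'v) approx \<Rightarrow> bool" where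
  "approx_le_p X Y \<longleftrightarrow> le_p (zeta X) (zeta Y)"

definition approx_le_t :: "('p, 'v::order) approx \<Rightarrow> ('p, 'v) approx \<Rightarrow> bool" where
  "approx_le_t X Y \<longleftrightarrow> le_t (zeta X) (zeta Y)"

definition is_least_fixpoint :: "('x \<Rightarrow> 'x \<Rightarrow> bool) \<Rightarrow> ('x \<Rightarrow> 'x) \<Rightarrow> 'x \<Rightarrow> bool" where
  "is_least_fixpoint le f x \<longleftrightarrow> f x = x \<and> (\<forall>y. f y = y \<longrightarrow> le x y)"

text \<open>
  The constant \<open>lfp\<close> is the infimum of the prefixpoints, which is the least fixpoint of a monotone
  operator.  The operator \<open>F_op\<close> below is in general not monotone with respect to \<open>\<le>\<^sub>t\<close>
  (it is on the set of all \<open>Y\<close> with first component \<open>bot\<close>, which contains its range),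
  and the infimum of its prefixpoints need not be a fixpoint.  Hence least fixpoints with respect
  to \<open>\<le>\<^sub>t\<close> and \<open>\<le>\<^sub>p\<close> are taken literally; that they exist is proved at the end.
\<close>

definition least_fixpoint :: "('x \<Rightarrow> 'x \<Rightarrow> bool) \<Rightarrow> ('x \<Rightarrow> 'x) \<Rightarrow> 'x" where
  "least_fixpoint le f = (THE x. is_least_fixpoint le f x)"


section \<open>The operator on pairs of interpretations and its stable operator\<close>

primrec eval_pair ::
  "('v, 'c, 'd, 'a) fuzzy_logic \<Rightarrow> ('p, 'v) interp \<times> ('p, 'v) interp
     \<Rightarrow> ('p, 'v, 'c, 'd, 'a) fuzzy_formula \<Rightarrow> 'v" where
  "eval_pair S LU (Const v) = v"
| "eval_pair S LU (Atom p) = fst LU p"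
| "eval_pair S LU (NegAtom p) = neg_tf S (snd LU p)"
| "eval_pair S LU (Conj c \<phi> \<psi>) = conj_tf S c (eval_pair S LU \<phi>) (eval_pair S LU \<psi>)"
| "eval_pair S LU (Disj d \<phi> \<psi>) = disj_tf S d (eval_pair S LU \<phi>) (eval_pair S LU \<psi>)"
| "eval_pair S LU (Aggr a \<phi>s) = aggr_tf S a (map (eval_pair S LU) \<phi>s)"

definition T_op ::
  "('v, 'c, 'd, 'a) fuzzy_logic \<Rightarrow> ('p, 'v, 'c, 'd, 'a) fuzzy_rule set
     \<Rightarrow> ('p, 'v) interp \<times> ('p, 'v) interp \<Rightarrow> ('p, 'v) interp \<times> ('p, 'v) interp" where
  "T_op S P = (\<lambda>(L, U). (\<lambda>p. eval_pair S (L, U) (body_of P p),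
                          \<lambda>p. eval_pair S (U, L) (body_of P p)))"

definition stable_op ::
  "('i::complete_lattice \<times> 'i \<Rightarrow> 'i \<times> 'i) \<Rightarrow> 'i \<times> 'i \<Rightarrow> 'i \<times> 'i" where
  "stable_op A = (\<lambda>(L, U). (lfp (\<lambda>Z. fst (A (Z, U))), lfp (\<lambda>Z. snd (A (L, Z)))))"


section \<open>The approximate well-founded operator\<close>

definition approx_inf ::
  "('p, 'v::lattice) approx \<Rightarrow> ('p, 'v) approx \<Rightarrow> ('p, 'v) approx"  (infixl "\<otimes>\<^sub>p" 70) where
  "X \<otimes>\<^sub>p Y = (\<lambda>p. (inf (fst (X p)) (fst (Y p)), sup (snd (X p)) (snd (Y p))))"

definition approx_sup ::
  "('p, 'v::lattice) approx \<Rightarrow> ('p, 'v) approx \<Rightarrow> ('p, 'v) approx"  (infixl "\<oplus>\<^sub>p" 65) where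
  "X \<oplus>\<^sub>p Y = (\<lambda>p. (sup (fst (X p)) (fst (Y p)), inf (snd (X p)) (snd (Y p))))"

primrec eval_approx ::
  "('v, 'c, 'd, 'a) fuzzy_logic \<Rightarrow> ('p, 'v) approx
     \<Rightarrow> ('p, 'v, 'c, 'd, 'a) fuzzy_formula \<Rightarrow> 'v \<times> 'v" where
  "eval_approx S X (Const v) = (v, v)"
| "eval_approx S X (Atom p) = X p"
| "eval_approx S X (NegAtom p) = (neg_tf S (snd (X p)), neg_tf S (fst (X p)))"
| "eval_approx S X (Conj c \<phi> \<psi>) =
     (conj_tf S c (fst (eval_approx S X \<phi>)) (fst (eval_approx S X \<psi>)),
      conj_tf S c (snd (eval_approx S X \<phi>)) (snd (eval_approx S X \<psi>)))"
| "eval_approx S X (Disj d \<phi> \<psi>) =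
     (disj_tf S d (fst (eval_approx S X \<phi>)) (fst (eval_approx S X \<psi>)),
      disj_tf S d (snd (eval_approx S X \<phi>)) (snd (eval_approx S X \<psi>)))"
| "eval_approx S X (Aggr a \<phi>s) =
     (aggr_tf S a (map fst (map (eval_approx S X) \<phi>s)),
      aggr_tf S a (map snd (map (eval_approx S X) \<phi>s)))"

definition S_op ::
  "('v, 'c, 'd, 'a) fuzzy_logic \<Rightarrow> ('p, 'v, 'c, 'd, 'a) fuzzy_rule set
     \<Rightarrow> ('p, 'v) approx \<Rightarrow> ('p, 'v) approx" where
  "S_op S P X = (\<lambda>p. eval_approx S X (body_of P p))"

definition X_false :: "('p, 'v::complete_lattice) approx" where
  "X_false = (\<lambda>p. (bot, bot))"

definition F_op ::
  "('v::complete_lattice, 'c, 'd, 'a) fuzzy_logic \<Rightarrow> ('p, 'v, 'c, 'd, 'a) fuzzy_rule set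
     \<Rightarrow> ('p, 'v) approx \<Rightarrow> ('p, 'v) approx \<Rightarrow> ('p, 'v) approx" where
  "F_op S P X Y = X_false \<otimes>\<^sub>p S_op S P (X \<oplus>\<^sub>p Y)"

definition s_op ::
  "('v::complete_lattice, 'c, 'd, 'a) fuzzy_logic \<Rightarrow> ('p, 'v, 'c, 'd, 'a) fuzzy_rule set
     \<Rightarrow> ('p, 'v) approx \<Rightarrow> ('p, 'v) approx" where
  "s_op S P X = least_fixpoint approx_le_t (F_op S P X)"

definition AW_op ::
  "('v::complete_lattice, 'c, 'd, 'a) fuzzy_logic \<Rightarrow> ('p, 'v, 'c, 'd, 'a) fuzzy_rule set
     \<Rightarrow> ('p, 'v) approx \<Rightarrow> ('p, 'v) approx" where
  "AW_op S P X = S_op S P X \<oplus>\<^sub>p s_op S P X"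

definition X_SWF ::
  "('v::complete_lattice, 'c, 'd, 'a) fuzzy_logic \<Rightarrow> ('p, 'v, 'c, 'd, 'a) fuzzy_rule set
     \<Rightarrow> ('p, 'v) approx" where
  "X_SWF S P = least_fixpoint approx_le_p (AW_op S P)"


section \<open>Existence of the least fixpoints\<close>

lemma is_least_fixpoint_unique:
  assumes "\<And>x y. le x y \<Longrightarrow> le y x \<Longrightarrow> x = y"
    and "is_least_fixpoint le f x" "is_least_fixpoint le f y"
  shows "x = y"
  using assms unfolding is_least_fixpoint_def by blast

lemma zeta_inject: "zeta X = zeta Y \<longleftrightarrow> X = Y"
  unfolding zeta_def by (auto simp: fun_eq_iff prod_eq_iff)

lemma le_p_antisym: "le_p x y \<Longrightarrow> le_p y x \<Longrightarrow> x = y"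
  by (auto simp: le_p_def prod_eq_iff intro: order.antisym)

lemma approx_le_p_antisym: "approx_le_p x y \<Longrightarrow> approx_le_p y x \<Longrightarrow> x = y"
  unfolding approx_le_p_def using le_p_antisym zeta_inject by blast

lemma approx_le_t_antisym: "approx_le_t x y \<Longrightarrow> approx_le_t y x \<Longrightarrow> x = y"
  unfolding approx_le_t_def le_t_def
  by (metis order.antisym prod_eq_iff zeta_inject)

lemma least_fixpoint_eq:
  assumes "\<And>x y. le x y \<Longrightarrow> le y x \<Longrightarrow> x = y" and "is_least_fixpoint le f x"
  shows "least_fixpoint le f = x"
  unfolding least_fixpoint_def
  using assms is_least_fixpoint_unique[OF assms(1)] by blast

lemma le_p_trans: "le_p x y \<Longrightarrow> le_p y z \<Longrightarrow> le_p x z"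
  by (auto simp: le_p_def intro: order_trans)

lemma ex_least_fixpoint_le_p:
  fixes f :: "'i::complete_lattice \<times> 'i \<Rightarrow> 'i \<times> 'i"
  assumes mono: "\<And>x y. le_p x y \<Longrightarrow> le_p (f x) (f y)"
  shows "\<exists>x. is_least_fixpoint le_p f x"
proof -
  define A where "A = {x. le_p (f x) x}"
  define m where "m = (Inf (fst ` A), Sup (snd ` A))"
  have lower: "le_p m x" if "x \<in> A" for x
    using that by (auto simp: m_def le_p_def intro: INF_lower SUP_upper)
  have great: "le_p y m" if "\<And>x. x \<in> A \<Longrightarrow> le_p y x" for y
    using that by (auto simp: m_def le_p_def intro!: INF_greatest SUP_least)
  have 1: "le_p (f m) m"
  proof (rule great)
    fix x assume x: "x \<in> A"
    from mono[OF lower[OF x]] show "le_p (f m) x"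
      using x le_p_trans unfolding A_def by blast
  qed
  have 2: "le_p m (f m)"
    by (rule lower) (simp add: A_def mono[OF 1])
  have "is_least_fixpoint le_p f m"
    unfolding is_least_fixpoint_def
    using le_p_antisym[OF 1 2] lower by (auto simp: A_def le_p_def)
  then show ?thesis ..
qed

context fuzzy_logic
begin

lemma aggr_mono_list:
  assumes "length vs = arity S a" "length ws = arity S a"
    and "\<And>i. i < arity S a \<Longrightarrow> vs ! i \<le> ws ! i"
  shows "aggr_tf S a vs \<le> aggr_tf S a ws"
proof -
  have "aggr_tf S a vs \<le> aggr_tf S a (take k ws @ drop k vs)" if "k \<le> arity S a" for k
    using that
  proof (induction k)
    case (Suc k)
    let ?u = "take k ws @ drop k vs"
    have k: "k < arity S a" using Suc.prems by simp
    have "?u[k := ws ! k] = take (Suc k) ws @ drop (Suc k) vs"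
      using k assms(1,2)
      by (auto simp: take_Suc_conv_app_nth list_update_append Cons_nth_drop_Suc[symmetric])
    moreover have "aggr_tf S a ?u \<le> aggr_tf S a (?u[k := ws ! k])"
      using k assms by (intro aggr_mono) (auto simp: nth_append)
    ultimately show ?case using Suc by (auto intro: order_trans)
  qed simp
  from this[of "arity S a"] assms show ?thesis by simp
qed

lemma eval_pair_mono:
  assumes "wf_formula S \<phi>" and "le_p LU LU'"
  shows "eval_pair S LU \<phi> \<le> eval_pair S LU' \<phi>"
  using assms(1)
proof (induction \<phi>)
  case (NegAtom p)
  then show ?case
    using assms(2) neg_antimono by (auto simp: le_p_def le_fun_def antimono_def)
next
  case (Conj c \<phi> \<psi>)
  then show ?case by (auto intro: order_trans[OF conj_mono1 conj_mono2])
next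
  case (Disj c \<phi> \<psi>)
  then show ?case by (auto intro: order_trans[OF disj_mono1 disj_mono2])
next
  case (Aggr a \<phi>s)
  then show ?case by (auto simp: list_all_iff intro!: aggr_mono_list)
qed (use assms(2) in \<open>auto simp: le_p_def le_fun_def\<close>)

lemma eval_approx_conv_pair:
  "eval_approx S X \<phi> = (eval_pair S (zeta X) \<phi>, eval_pair S (prod.swap (zeta X)) \<phi>)"
  by (induction \<phi>) (auto simp: zeta_def comp_def cong: map_cong)

lemma zeta_S_op: "zeta (S_op S P X) = T_op S P (zeta X)"
  by (simp add: zeta_def S_op_def T_op_def eval_approx_conv_pair)

end

locale fuzzy_program = fuzzy_logic S
  for S :: "('v::complete_lattice, 'c, 'd, 'a) fuzzy_logic" +
  fixes P :: "('p, 'v, 'c, 'd, 'a) fuzzy_rule set"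
  assumes program: "normal_program S P"
    and one_rule: "\<exists>!r. r \<in> P \<and> rhead r = p"
begin

lemma wf_body: "wf_formula S (body_of P p)"
  using theI'[OF one_rule[of p]] program by (auto simp: body_of_def normal_program_def)

lemma T_op_mono: "le_p x y \<Longrightarrow> le_p (T_op S P x) (T_op S P y)"
  by (auto simp: T_op_def le_p_def le_fun_def split: prod.splits
      intro!: eval_pair_mono wf_body)

lemma stable_mono:
  assumes "le_p x y"
  shows "le_p (stable_op (T_op S P) x) (stable_op (T_op S P) y)"
proof -
  obtain L U L' U' where xy: "x = (L, U)" "y = (L', U')" by (metis surj_pair)
  with assms have "L \<le> L'" "U' \<le> U" by (auto simp: le_p_def)
  then have "fst (T_op S P (Z, U)) \<le> fst (T_op S P (Z, U'))"
    and "snd (T_op S P (L', Z)) \<le> snd (T_op S P (L, Z))" for Z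
    using T_op_mono[of "(Z, U)" "(Z, U')"] T_op_mono[of "(L, Z)" "(L', Z)"]
    by (auto simp: le_p_def)
  then show ?thesis
    unfolding xy stable_op_def by (auto simp: le_p_def intro!: lfp_mono)
qed

theorem ex_least_fixpoint_stable: "\<exists>x. is_least_fixpoint le_p (stable_op (T_op S P)) x"
  by (rule ex_least_fixpoint_le_p) (rule stable_mono)

lemma zeta_F_op:
  "zeta (F_op S P X Y) =
     (bot, snd (T_op S P (sup (fst (zeta X)) (fst (zeta Y)), inf (snd (zeta X)) (snd (zeta Y)))))"
  by (simp add: F_op_def approx_inf_def approx_sup_def X_false_def zeta_def T_op_def S_op_def
      eval_approx_conv_pair fun_eq_iff sup_fun_def inf_fun_def)

definition s_snd :: "('p \<Rightarrow> 'v) \<times> ('p \<Rightarrow> 'v) \<Rightarrow> 'p \<Rightarrow> 'v" where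
  "s_snd x = lfp (\<lambda>Z. snd (T_op S P (fst x, inf (snd x) Z)))"

lemma s_snd_operator_mono: "mono (\<lambda>Z. snd (T_op S P (fst x, inf (snd x) Z)))"
proof (rule monoI)
  fix Z Z' :: "'p \<Rightarrow> 'v" assume "Z \<le> Z'"
  then have "le_p (fst x, inf (snd x) Z') (fst x, inf (snd x) Z)"
    by (auto simp: le_p_def intro: le_infI2)
  from T_op_mono[OF this]
  show "snd (T_op S P (fst x, inf (snd x) Z)) \<le> snd (T_op S P (fst x, inf (snd x) Z'))"
    by (simp add: le_p_def)
qed

lemma is_least_fixpoint_F_op:
  "is_least_fixpoint approx_le_t (F_op S P X) (\<lambda>p. (bot, s_snd (zeta X) p))"
    (is "is_least_fixpoint _ _ ?Y")
proof -
  have zY: "zeta ?Y = (bot, s_snd (zeta X))"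
    by (simp add: zeta_def fun_eq_iff)
  have "zeta (F_op S P X ?Y) = zeta ?Y"
    unfolding zeta_F_op zY fst_conv snd_conv sup_bot_right
    using lfp_unfold[OF s_snd_operator_mono[of "zeta X"]] by (simp add: s_snd_def)
  moreover have "approx_le_t ?Y Z" if Z: "F_op S P X Z = Z" for Z
  proof -
    have z1: "fst (zeta Z) = bot"
      using zeta_F_op[of X Z] unfolding Z by (metis fst_conv)
    have z2: "snd (zeta Z) = snd (T_op S P (sup (fst (zeta X)) (fst (zeta Z)),
                                inf (snd (zeta X)) (snd (zeta Z))))"
      using zeta_F_op[of X Z] unfolding Z by (metis snd_conv)
    have "s_snd (zeta X) \<le> snd (zeta Z)"
      unfolding s_snd_def by (rule lfp_lowerbound) (use z1 z2 in simp)
    then show ?thesis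
      unfolding approx_le_t_def le_t_def zY by simp
  qed
  ultimately show ?thesis
    by (simp add: is_least_fixpoint_def zeta_inject)
qed

lemma s_op_eq: "s_op S P X = (\<lambda>p. (bot, s_snd (zeta X) p))"
  unfolding s_op_def
  by (rule least_fixpoint_eq[OF approx_le_t_antisym is_least_fixpoint_F_op])

definition AW_pair :: "('p \<Rightarrow> 'v) \<times> ('p \<Rightarrow> 'v) \<Rightarrow> ('p \<Rightarrow> 'v) \<times> ('p \<Rightarrow> 'v)" where
  "AW_pair x = (fst (T_op S P x), inf (snd (T_op S P x)) (s_snd x))"

lemma zeta_AW_op: "zeta (AW_op S P X) = AW_pair (zeta X)"
  by (simp add: AW_op_def AW_pair_def s_op_eq approx_sup_def zeta_S_op[symmetric])
    (simp add: zeta_def inf_fun_def)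

lemma AW_pair_mono:
  assumes "le_p x y"
  shows "le_p (AW_pair x) (AW_pair y)"
proof -
  have "s_snd y \<le> s_snd x"
    unfolding s_snd_def
  proof (rule lfp_mono)
    fix Z
    have "le_p (fst x, inf (snd x) Z) (fst y, inf (snd y) Z)"
      using assms by (auto simp: le_p_def intro: le_infI1)
    from T_op_mono[OF this]
    show "snd (T_op S P (fst y, inf (snd y) Z)) \<le> snd (T_op S P (fst x, inf (snd x) Z))"
      by (simp add: le_p_def)
  qed
  then show ?thesis
    using T_op_mono[OF assms] by (auto simp: AW_pair_def le_p_def intro: le_infI1 le_infI2)
qed

theorem ex_least_fixpoint_AW: "\<exists>X. is_least_fixpoint approx_le_p (AW_op S P) X"
proof -
  obtain m where m: "is_least_fixpoint le_p AW_pair m"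
    using ex_least_fixpoint_le_p[of AW_pair] AW_pair_mono by blast
  define X where "X = (\<lambda>p. (fst m p, snd m p))"
  have zX: "zeta X = m" by (simp add: X_def zeta_def)
  have "is_least_fixpoint approx_le_p (AW_op S P) X"
    unfolding is_least_fixpoint_def approx_le_p_def zX
    using m zeta_AW_op zX unfolding is_least_fixpoint_def by (metis zeta_inject)
  then show ?thesis by blast
qed

end

end

(* Write G (L, U) for the second component of T_P (L, U), so that the first one is G (U, L), and
   C L for the least fixpoint of G (L, -). A stable fixpoint (L, U), i.e. L = C U and U = C L, is a
   fixpoint of AW_P. Conversely, a fixpoint (L, U) of AW_P satisfies L = G (U, L) and U \<le> C L,
   so C U \<le> L and (L, U) is a prefixpoint of the stable operator, hence lies above its least
   fixpoint. *)

theory Submission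
  imports Defs
begin

text \<open>\<open>is_least_fixpoint\<close> compares \<open>m\<close> with fixpoints only.
  Prefixpoints are covered too, because monotonicity yields a fixpoint of \<open>f\<close> below any
  prefixpoint \<open>x\<close>.\<close>

lemma least_fixpoint_le_p_prefixpoint:
  fixes f :: "'i::complete_lattice \<times> 'i \<Rightarrow> 'i \<times> 'i"
  assumes mono: "\<And>x y. le_p x y \<Longrightarrow> le_p (f x) (f y)"
    and least: "is_least_fixpoint le_p f m"
    and pre: "le_p (f x) x"
  shows "le_p m x"
proof -
  \<comment> \<open>The \<open>le_p\<close>-meet of \<open>f y\<close> and \<open>x\<close>:
    \<open>f\<close> truncated so that all its values, hence all its fixpoints, lie below
    \<open>x\<close>.\<close>
  define g where "g y = (inf (fst (f y)) (fst x), sup (snd (f y)) (snd x))" for y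
  have "le_p (g y) (g z)" if "le_p y z" for y z
    using mono[OF that] by (auto simp: g_def le_p_def intro: le_infI1 le_supI1)
  then obtain n where n: "g n = n"
    using ex_least_fixpoint_le_p[of g] by (auto simp: is_least_fixpoint_def)
  have "le_p (g n) x"
    by (simp add: g_def le_p_def)
  then have nx: "le_p n x"
    by (simp add: n)
  have "le_p (f n) x"
    using le_p_trans[OF mono[OF nx] pre] .
  \<comment> \<open>Since \<open>f n\<close> already lies below \<open>x\<close>, the truncation
    does nothing at \<open>n\<close>, so \<open>n\<close> is a fixpoint of \<open>f\<close>
    itself.\<close>
  then have "g n = f n"
    by (simp add: g_def le_p_def prod_eq_iff inf_absorb1 sup_absorb1)
  then have "le_p m n"
    using least n unfolding is_least_fixpoint_def by metis
  then show ?thesis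
    using nx le_p_trans by blast
qed

context fuzzy_program
begin

lemma fst_T_op: "fst (T_op S P (L, U)) = snd (T_op S P (U, L))"
  by (simp add: T_op_def)

lemma mono_snd_T_op: "mono (\<lambda>Z. snd (T_op S P (L, Z)))"
  using T_op_mono[of "(L, Z')" "(L, Z)" for Z Z'] by (auto simp: le_p_def intro!: monoI)

lemma stable_op_eq:
  "stable_op (T_op S P) (L, U) =
    (lfp (\<lambda>Z. snd (T_op S P (U, Z))), lfp (\<lambda>Z. snd (T_op S P (L, Z))))"
  by (simp add: stable_op_def fst_T_op)

text \<open>Capping the argument by \<open>U\<close> can only lower the operator, so
  \<open>?C\<close> is a prefixpoint of the capped operator that defines
  \<open>s_snd\<close>.\<close>

lemma s_snd_le: "s_snd (L, U) \<le> lfp (\<lambda>Z. snd (T_op S P (L, Z)))" (is "_ \<le> ?C")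
proof -
  have "snd (T_op S P (L, inf U ?C)) \<le> snd (T_op S P (L, ?C))"
    by (rule monoD[OF mono_snd_T_op]) simp
  also have "\<dots> = ?C"
    using lfp_unfold[OF mono_snd_T_op] by metis
  finally show ?thesis
    unfolding s_snd_def by (simp add: lfp_lowerbound)
qed

lemma s_snd_unfold: "s_snd (L, U) = snd (T_op S P (L, inf U (s_snd (L, U))))"
  using lfp_unfold[OF s_snd_operator_mono[of "(L, U)"]] by (simp add: s_snd_def)

lemma AW_pair_stable_fixpoint:
  assumes "stable_op (T_op S P) x = x"
  shows "AW_pair x = x"
proof -
  obtain L U where x: "x = (L, U)" by (metis surj_pair)
  have L: "lfp (\<lambda>Z. snd (T_op S P (U, Z))) = L" and U: "lfp (\<lambda>Z. snd (T_op S P (L, Z))) = U"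
    using assms unfolding x stable_op_eq by simp_all
  have LG: "snd (T_op S P (U, L)) = L" and UG: "snd (T_op S P (L, U)) = U"
    using lfp_unfold[OF mono_snd_T_op[of U]] lfp_unfold[OF mono_snd_T_op[of L]]
    unfolding L U by simp_all
  have le: "s_snd (L, U) \<le> U"
    using s_snd_le[of L U] unfolding U .
  \<comment> \<open>Below \<open>U\<close> the cap \<open>inf U\<close> is void, so
    \<open>s_snd (L, U)\<close> is a fixpoint of the uncapped operator, whose least fixpoint is
    \<open>U\<close>.\<close>
  then have "snd (T_op S P (L, s_snd (L, U))) = s_snd (L, U)"
    using s_snd_unfold[of L U] by (simp add: inf_absorb2)
  then have "U \<le> s_snd (L, U)"
    using lfp_lowerbound[of "\<lambda>Z. snd (T_op S P (L, Z))" "s_snd (L, U)"] unfolding U by simp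
  with le have "s_snd (L, U) = U"
    by (rule order.antisym)
  then show ?thesis
    by (simp add: x AW_pair_def fst_T_op LG UG)
qed

lemma stable_prefixpoint_AW_pair:
  assumes "AW_pair x = x"
  shows "le_p (stable_op (T_op S P) x) x"
proof -
  obtain L U where x: "x = (L, U)" by (metis surj_pair)
  have "snd (T_op S P (U, L)) = L" and U: "U = inf (snd (T_op S P (L, U))) (s_snd (L, U))"
    using assms by (simp_all add: x AW_pair_def fst_T_op)
  then have "lfp (\<lambda>Z. snd (T_op S P (U, Z))) \<le> L"
    by (simp add: lfp_lowerbound)
  moreover have "U \<le> s_snd (L, U)"
    by (subst U) (rule inf_le2)
  then have "U \<le> lfp (\<lambda>Z. snd (T_op S P (L, Z)))"
    using s_snd_le by (rule order_trans)
  ultimately show ?thesis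
    by (simp add: x stable_op_eq le_p_def)
qed

text \<open>Transfers the least fixpoint along the bijection \<open>zeta\<close>, so that both
  operators can be compared on pairs of interpretations.\<close>

lemma is_least_fixpoint_AW_pair_zeta_X_SWF: "is_least_fixpoint le_p AW_pair (zeta (X_SWF S P))"
proof -
  have least: "is_least_fixpoint approx_le_p (AW_op S P) (X_SWF S P)"
    using ex_least_fixpoint_AW least_fixpoint_eq[OF approx_le_p_antisym]
    unfolding X_SWF_def by metis
  then have "AW_pair (zeta (X_SWF S P)) = zeta (X_SWF S P)"
    by (simp add: is_least_fixpoint_def flip: zeta_AW_op)
  moreover have "le_p (zeta (X_SWF S P)) y" if "AW_pair y = y" for y
  proof -
    \<comment> \<open>The preimage of \<open>y\<close> under \<open>zeta\<close>.\<close>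
    define Y where "Y = (\<lambda>p. (fst y p, snd y p))"
    have Y: "zeta Y = y"
      by (simp add: Y_def zeta_def)
    then have "AW_op S P Y = Y"
      using that by (simp add: zeta_AW_op flip: zeta_inject)
    then show ?thesis
      using least Y by (auto simp: is_least_fixpoint_def approx_le_p_def)
  qed
  ultimately show ?thesis
    by (simp add: is_least_fixpoint_def)
qed

lemma zeta_X_SWF: "zeta (X_SWF S P) = least_fixpoint le_p (stable_op (T_op S P))"
proof -
  obtain m where m: "is_least_fixpoint le_p (stable_op (T_op S P)) m"
    using ex_least_fixpoint_stable by blast
  have "AW_pair m = m"
    using m by (intro AW_pair_stable_fixpoint) (simp add: is_least_fixpoint_def)
  then have "le_p (zeta (X_SWF S P)) m"
    using is_least_fixpoint_AW_pair_zeta_X_SWF unfolding is_least_fixpoint_def by blast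
  moreover have "AW_pair (zeta (X_SWF S P)) = zeta (X_SWF S P)"
    using is_least_fixpoint_AW_pair_zeta_X_SWF by (simp add: is_least_fixpoint_def)
  \<comment> \<open>A fixpoint of \<open>AW_pair\<close> is known only to be a prefixpoint of the
    stable operator, which is enough here.\<close>
  then have "le_p m (zeta (X_SWF S P))"
    using least_fixpoint_le_p_prefixpoint[OF stable_mono m] stable_prefixpoint_AW_pair by blast
  ultimately have "zeta (X_SWF S P) = m"
    by (rule le_p_antisym)
  then show ?thesis
    using least_fixpoint_eq[OF le_p_antisym m] by simp
qed

end

theorem theorem4:
  fixes S :: "('v::complete_lattice, 'c, 'd, 'a) fuzzy_logic"
    and P :: "('p, 'v, 'c, 'd, 'a) fuzzy_rule set"
  assumes "fuzzy_logic S"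
    and "normal_program S P"
    and "\<forall>p. \<exists>!r. r \<in> P \<and> rhead r = p"
    and "\<forall>r\<in>P. weight r = top"
  shows "zeta (X_SWF S P) = least_fixpoint le_p (stable_op (T_op S P))"
proof -
  interpret fuzzy_program S P
    using assms(1-3) by (simp add: fuzzy_program_def fuzzy_program_axioms_def)
  show ?thesis
    by (rule zeta_X_SWF)
qed

end
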